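(* Let $\mathbb K$ be a field of characteristic zero and let $A\subset \mathbb K^{d+1}$ be a homogeneous, non-pyramidal configuration with cardinality $n$ and affine dimension $d$. Let $m=n-d-1$. Let $\rho(A)$ be the maximum of $\operatorname{rank}M_{\underline\sigma}(A)$ over all maximal chains $\underline\sigma$ of supports of vectors in $\ker_{\mathbb K}(A)$, and let $\lambda(A)$ be the maximal length of a non-splitting flag in a Gale dual of $A$. Then $$n-1-\rho(A)=m-1-\lambda(A).$$
   Context: A configuration over $\mathbb K$ is a finite indexed family $A=\{a_1,\dots,a_n\}$ of not necessarily distinct points in $\mathbb K^e$, identified with the $e\times n$ matrix with columns $a_i$. Its affine dimension is the dimension of its affine span. $A$ is homogeneous if $(1,\dots,1)$ lies in the row span of the matrix $A$. $A$ is a pyramid if some affine hyperplane contains all points of $A$ except one (equivalently, some $a_i$ is not in the affine span of the other points); otherwise it is non-pyramidal. Supports: the support of $v\in\mathbb K^n$ is the $0/1$ vector with ones at the positions where $v$ is nonzero; supports are ordered by inclusion. A maximal chain of (nonzero) supports of vectors in $\ker_{\mathbb K}(A)$ has the form $\underline\sigma=\{\sigma_1\prec\cdots\prec\sigma_m\}$, and $M_{\underline\sigma}(A)$ is the $n\times n$ matrix obtained by stacking the rows $\sigma_1,\dots,\sigma_m$ below the matrix $A$. Gale dual: a configuration $B=\{b_1,\dots,b_n\}\subset\mathbb K^m$ given by the rows of an $n\times m$ matrix whose columns are a basis of $\ker_{\mathbb K}(A)$. For a subfamily $C\subset B$, $L(C)$ is its linear span and $\mathfrak s(C)=\sum_{b\in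 C}b$ (sum over indices). A flat of $B$ is a subfamily $F$ containing every element of $B$ that lies in $L(F)$; its rank is $\dim L(F)$. A flag of length $\ell$ is a chain of flats $F_1\subset\dots\subset F_\ell$ with $\operatorname{rank}F_j=j$; it is non-splitting if $\mathfrak s(F_1)\ne0$ and $\mathfrak s(F_j)\notin L(F_{j-1})$ for $2\le j\le\ell$. $\lambda(A)=\lambda(B)$ is the maximal length of a non-splitting flag in $B$ ($0$ if there is none); it does not depend on the choice of $B$. *)

theory Defs
  imports "Jordan_Normal_Form.Matrix_Kernel" "Jordan_Normal_Form.DL_Rank"
begin

text \<open>
  A configuration of \<open>n\<close> points in \<open>K^e\<close> is the \<open>e\<close> times \<open>n\<close> matrix whose columns are the points;
  a Gale dual is given by the rows of its matrix. Subfamilies of a Gale dual are encoded as sets of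
  row indices, so that repeated elements are counted with multiplicity.
\<close>

definition span_dim :: "nat \<Rightarrow> 'a :: field vec set \<Rightarrow> nat" where
  "span_dim e S = vectorspace.dim class_ring
     ((module_vec TYPE('a) e)\<lparr>carrier :=
        LinearCombinations.module.span class_ring (module_vec TYPE('a) e) S\<rparr>)"

definition affine_span :: "'a :: field mat \<Rightarrow> 'a vec set" where
  "affine_span A = {A *\<^sub>v c | c. c \<in> carrier_vec (dim_col A) \<and> (\<Sum>i<dim_col A. c $ i) = 1}"

text \<open>The dimension of an affine subspace is that of its direction space; the empty
  affine subspace has dimension \<open>- 1\<close>.\<close>

definition affine_dim :: "'a :: field mat \<Rightarrow> int" where
  "affine_dim A = (if affine_span A = {} then - 1
     else int (span_dim (dim_row A) {x - y | x y. x \<in> affine_span A \<and> y \<in> affine_span A}))"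

definition homogeneous :: "'a :: field mat \<Rightarrow> bool" where
  "homogeneous A \<longleftrightarrow> vec (dim_col A) (\<lambda>_. 1) \<in> vec_space.row_space (dim_col A) A"

text \<open>The affine hyperplane is \<open>{x. w \<bullet> x = c}\<close>. ``Except one'' refers to the index \<open>i\<close>.\<close>

definition pyramid :: "'a :: field mat \<Rightarrow> bool" where
  "pyramid A \<longleftrightarrow> (\<exists>w \<in> carrier_vec (dim_row A). \<exists>c. w \<noteq> 0\<^sub>v (dim_row A) \<and>
     (\<exists>i < dim_col A. w \<bullet> col A i \<noteq> c \<and> (\<forall>j < dim_col A. j \<noteq> i \<longrightarrow> w \<bullet> col A j = c)))"

definition supp :: "'a :: field vec \<Rightarrow> 'a vec" where
  "supp v = vec (dim_vec v) (\<lambda>i. if v $ i \<noteq> 0 then 1 else 0)"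

definition supp_less :: "'a :: field vec \<Rightarrow> 'a vec \<Rightarrow> bool" where
  "supp_less s t \<longleftrightarrow> {i. i < dim_vec s \<and> s $ i \<noteq> 0} \<subset> {i. i < dim_vec t \<and> t $ i \<noteq> 0}"

definition kernel_supports :: "'a :: field mat \<Rightarrow> 'a vec set" where
  "kernel_supports A = {supp v | v. v \<in> mat_kernel A \<and> v \<noteq> 0\<^sub>v (dim_col A)}"

definition maximal_support_chain :: "'a :: field mat \<Rightarrow> 'a vec list \<Rightarrow> bool" where
  "maximal_support_chain A ss \<longleftrightarrow>
     sorted_wrt supp_less ss \<and> pred_on.maxchain (kernel_supports A) supp_less (set ss)"

definition chain_matrix :: "'a :: field mat \<Rightarrow> 'a vec list \<Rightarrow> 'a mat" where
  "chain_matrix A ss = A @\<^sub>r mat_of_rows (dim_col A) ss"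

definition rho :: "'a :: field mat \<Rightarrow> nat" where
  "rho A = Max {vec_space.rank (dim_row (chain_matrix A ss)) (chain_matrix A ss) | ss.
                  maximal_support_chain A ss}"

definition gale_dual :: "'a :: field mat \<Rightarrow> 'a mat \<Rightarrow> bool" where
  "gale_dual A B \<longleftrightarrow> dim_row B = dim_col A \<and> distinct (cols B) \<and>
     kernel.basis (dim_col A) A (set (cols B))"

definition fam_span :: "'a :: field mat \<Rightarrow> nat set \<Rightarrow> 'a vec set" where
  "fam_span B C =
     LinearCombinations.module.span class_ring (module_vec TYPE('a) (dim_col B)) (row B ` C)"

definition fam_rank :: "'a :: field mat \<Rightarrow> nat set \<Rightarrow> nat" where
  "fam_rank B C = span_dim (dim_col B) (row B ` C)"

definition fam_sum :: "'a :: field mat \<Rightarrow> nat set \<Rightarrow> 'a vec" where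
  "fam_sum B C = finsum_vec TYPE('a) (dim_col B) (row B) C"

definition flat :: "'a :: field mat \<Rightarrow> nat set \<Rightarrow> bool" where
  "flat B F \<longleftrightarrow> F \<subseteq> {..<dim_row B} \<and> (\<forall>i < dim_row B. row B i \<in> fam_span B F \<longrightarrow> i \<in> F)"

text \<open>Lists are indexed from \<open>0\<close>, so the member \<open>F\<^sub>j\<close> of a flag is \<open>Fs ! (j - 1)\<close>.\<close>

definition flag :: "'a :: field mat \<Rightarrow> nat set list \<Rightarrow> bool" where
  "flag B Fs \<longleftrightarrow> sorted_wrt (\<subset>) Fs \<and>
     (\<forall>j < length Fs. flat B (Fs ! j) \<and> fam_rank B (Fs ! j) = j + 1)"

definition non_splitting :: "'a :: field mat \<Rightarrow> nat set list \<Rightarrow> bool" where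
  "non_splitting B Fs \<longleftrightarrow>
     (Fs \<noteq> [] \<longrightarrow> fam_sum B (Fs ! 0) \<noteq> 0\<^sub>v (dim_col B)) \<and>
     (\<forall>j. j + 1 < length Fs \<longrightarrow> fam_sum B (Fs ! (j + 1)) \<notin> fam_span B (Fs ! j))"

text \<open>The empty list is a non-splitting flag, which gives the value \<open>0\<close> when there is no
  non-splitting flag of positive length.\<close>

definition lambda :: "'a :: field mat \<Rightarrow> nat" where
  "lambda B = Max {length Fs | Fs. flag B Fs \<and> non_splitting B Fs}"

end

theory Submission
  imports Defs
begin

text \<open>
  Write \<open>s(C)\<close> for the sum of a subfamily \<open>C\<close> of \<open>B\<close> and \<open>L(C)\<close> for its span. The kernel of \<open>A\<close> is
  the image of \<open>B\<close>, so the zero set of a kernel vector is a flat of \<open>B\<close>; over an infinite field a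
  flat \<open>F\<close> is conversely the zero set of \<open>B u\<close> for a generic \<open>u\<close> orthogonal to \<open>F\<close>. Chains of
  supports are thus the complements of chains of proper flats.

  The kernel of \<open>B\<^sup>T\<close> is the row space of \<open>A\<close>. Hence stacking rows \<open>\<sigma>\<close> below \<open>A\<close> raises the rank by
  the dimension of the span of the vectors \<open>B\<^sup>T \<sigma>\<close> (\<open>span_dim_rows_Un\<close>). If \<open>\<sigma>\<close> is the support
  with zero set \<open>F\<close>, then \<open>B\<^sup>T \<sigma> = - s(F)\<close>, because homogeneity makes the sum of all rows of \<open>B\<close>
  vanish. Since \<open>rank A = d + 1\<close>, the theorem amounts to the following: the maximum of
  \<open>dim \<langle>s(F\<^sub>1), s(F\<^sub>2), \<dots>\<rangle>\<close> over chains of flats is the maximal length of a non-splitting flag.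

  One inequality is triangularity: in a non-splitting flag \<open>s(F\<^sub>j)\<close> lies in \<open>L(F\<^sub>j)\<close> but not in
  \<open>L(F\<^bsub>j-1\<^esub>)\<close>, so these sums are independent (\<open>span_dim_nonsplitting_sums\<close>); and all members of the
  flag are proper flats, so they occur in the zero sets of some maximal chain of supports.

  The other inequality (\<open>nonsplitting_flag_from_chain\<close>) builds a long flag from a chain of flats
  \<open>E\<^sub>1 \<subseteq> E\<^sub>2 \<subseteq> \<dots>\<close> by a greedy procedure. Let \<open>F \<subseteq> E\<^sub>1\<close> be the last member of the
  non-splitting flag built so far. If \<open>s(E\<^sub>1) \<in> L(F)\<close>, then \<open>E\<^sub>1\<close> contributes nothing to the
  dimension of \<open>L(F) + \<langle>s(E\<^sub>1), s(E\<^sub>2), \<dots>\<rangle>\<close> and can be dropped. Otherwise let \<open>G\<close> run over the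
  flats covering \<open>F\<close> inside \<open>E\<^sub>1\<close>: the sets \<open>G - F\<close> partition \<open>E\<^sub>1 - F\<close>, so that
  modulo \<open>L(F)\<close> the vector \<open>s(E\<^sub>1)\<close> is the sum of the \<open>s(G)\<close>; hence some \<open>s(G)\<close> is not in \<open>L(F)\<close>
  (\<open>flat_grow\<close>), and \<open>G\<close> extends the flag. The dimension above never drops, and at the end, when no \<open>E\<^sub>i\<close> is left, it is \<open>dim L(F)\<close>, the length of the flag.
\<close>

section \<open>Dimensions of linear spans\<close>

abbreviation lin_span :: "nat \<Rightarrow> 'a :: field vec set \<Rightarrow> 'a vec set" where
  "lin_span e S \<equiv> LinearCombinations.module.span class_ring (module_vec TYPE('a) e) S"

lemma lin_span_mono:
  fixes S T :: "'a :: field vec set"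
  assumes "S \<subseteq> T"
  shows "lin_span e S \<subseteq> lin_span e T"
proof -
  interpret vec_space "TYPE('a)" e .
  show ?thesis using span_is_monotone[OF assms] .
qed

lemma subset_lin_span:
  fixes S :: "'a :: field vec set"
  assumes "S \<subseteq> carrier_vec e"
  shows "S \<subseteq> lin_span e S"
proof -
  interpret vec_space "TYPE('a)" e .
  show ?thesis using in_own_span[OF assms] .
qed

lemma lin_span_least:
  fixes S T :: "'a :: field vec set"
  assumes "T \<subseteq> carrier_vec e" "S \<subseteq> lin_span e T"
  shows "lin_span e S \<subseteq> lin_span e T"
proof -
  interpret vec_space "TYPE('a)" e .
  show ?thesis using span_subsetI[OF assms] .
qed

lemma maximal_indpt_span:
  fixes S :: "'a :: field vec set"
  assumes S: "S \<subseteq> carrier_vec e" "finite S"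
    and U: "maximal U (\<lambda>T. T \<subseteq> S \<and> \<not> module.lin_dep class_ring (module_vec TYPE('a) e) T)"
  shows "lin_span e U = lin_span e S"
proof -
  interpret vec_space "TYPE('a)" e .
  from U have US: "U \<subseteq> S" and ind: "lin_indpt U" by (auto simp: maximal_def)
  have "s \<in> span U" if s: "s \<in> S" for s
  proof (rule ccontr)
    assume n: "s \<notin> span U"
    have sU: "s \<notin> U" using n US S span_mem by (meson subset_trans)
    have "lin_indpt (U \<union> {s})" using lin_dep_iff_in_span[of U s] US S s ind n sU by blast
    then have "U \<union> {s} = U" using U s US unfolding maximal_def by blast
    with sU show False by blast
  qed
  then have "span S \<subseteq> span U" using span_subsetI[of U S] US S(1) by blast
  then show ?thesis using span_is_monotone[OF US] by blast
qed

lemma indpt_subset_basis: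
  fixes S :: "'a :: field vec set"
  assumes S: "S \<subseteq> carrier_vec e" "finite S"
  obtains U where "U \<subseteq> S" "\<not> module.lin_dep class_ring (module_vec TYPE('a) e) U"
    "lin_span e U = lin_span e S" "span_dim e S = card U"
proof -
  interpret vec_space "TYPE('a)" e .
  have "lin_indpt {}" using finite_lin_indpt2[of "{}"] by simp
  then obtain U where U: "maximal U (\<lambda>T. T \<subseteq> S \<and> lin_indpt T)"
    using maximal_exists_superset[OF S(2), of "\<lambda>T. T \<subseteq> S \<and> lin_indpt T" "{}"] by blast
  show ?thesis
    using that[of U] U maximal_indpt_span[OF S U] dim_span[OF S U]
    unfolding maximal_def span_dim_def by auto
qed

lemma span_dim_empty: "span_dim e ({} :: 'a :: field vec set) = 0"
  by (rule indpt_subset_basis[of "{} :: 'a vec set" e]) simp_all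

lemma span_dim_cong: "lin_span e S = lin_span e T \<Longrightarrow> span_dim e S = span_dim e T"
  by (simp add: span_dim_def)

text \<open>Together with \<open>span_dim_empty\<close> this determines \<open>span_dim\<close> on finite sets; all
  later dimension counts add one vector at a time.\<close>

lemma span_dim_insert:
  fixes S :: "'a :: field vec set"
  assumes S: "S \<subseteq> carrier_vec e" "finite S" and v: "v \<in> carrier_vec e"
  shows "span_dim e (insert v S) = span_dim e S + (if v \<in> lin_span e S then 0 else 1)"
proof -
  interpret vec_space "TYPE('a)" e .
  show ?thesis
  proof (cases "v \<in> span S")
    case True
    have "span (insert v S) \<subseteq> span S" using span_subsetI[of S "insert v S"] in_own_span[OF S(1)] S(1) True by blast
    then have "span (insert v S) = span S" using span_is_monotone[of S "insert v S"] by blast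
    then show ?thesis using True span_dim_cong[of e "insert v S" S] by simp
  next
    case False
    obtain U where U: "U \<subseteq> S" "lin_indpt U" "span U = span S" "span_dim e S = card U"
      using indpt_subset_basis[OF S] .
    have Uc: "U \<subseteq> carrier_vec e" and fU: "finite U" using U(1) S finite_subset by blast+
    have vU: "v \<notin> U" using False U span_mem[OF Uc] by blast
    have ind: "lin_indpt (insert v U)"
      using lin_dep_iff_in_span[OF Uc U(2) v vU] False U(3) by simp
    have ic: "insert v U \<subseteq> carrier_vec e" using Uc v by blast
    have sub: "insert v S \<subseteq> span (insert v U)"
    proof -
      have "S \<subseteq> span U" using U(3) in_own_span[OF S(1)] by simp
      also have "\<dots> \<subseteq> span (insert v U)" by (rule span_is_monotone) auto
      finally show ?thesis using in_own_span[OF ic] by simp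
    qed
    have sp: "span (insert v U) = span (insert v S)"
      using span_subsetI[OF ic sub] span_is_monotone[of "insert v U" "insert v S"] U(1) by blast
    have "maximal (insert v U) (\<lambda>T. T \<subseteq> insert v U \<and> lin_indpt T)"
      using ind unfolding maximal_def by blast
    then have "span_dim e (insert v U) = card (insert v U)"
      using dim_span[OF ic] fU unfolding span_dim_def by simp
    then show ?thesis using False vU fU U(4) span_dim_cong[OF sp] by simp
  qed
qed

lemma span_dim_le_card:
  fixes S :: "'a :: field vec set"
  assumes "S \<subseteq> carrier_vec e" "finite S"
  shows "span_dim e S \<le> card S"
  using assms(2,1)
proof (induction S rule: finite_induct)
  case (insert v S)
  then show ?case using span_dim_insert[of S e v] by auto
qed (simp add: span_dim_empty)

lemma span_dim_mono:
  fixes S T :: "'a :: field vec set"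
  assumes T: "T \<subseteq> carrier_vec e" "finite T" and S: "S \<subseteq> lin_span e T" "finite S"
  shows "span_dim e S \<le> span_dim e T"
proof -
  interpret vec_space "TYPE('a)" e .
  have Sc: "S \<subseteq> carrier_vec e" using subset_trans[OF S(1) span_is_subset2[OF T(1)]] by simp
  have "span (T \<union> S) \<subseteq> span T" using span_subsetI[OF T(1), of "T \<union> S"] S(1) in_own_span[OF T(1)] by simp
  then have "span_dim e T = span_dim e (T \<union> S)"
    using span_is_monotone[of T "T \<union> S"] by (intro span_dim_cong subset_antisym) simp_all
  moreover have "span_dim e S \<le> span_dim e (X \<union> S)" if "finite X" "X \<subseteq> carrier_vec e" for X
    using that
  proof (induction X rule: finite_induct)
    case (insert x X)
    have "span_dim e S \<le> span_dim e (X \<union> S)" using insert by auto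
    also have "\<dots> \<le> span_dim e (insert x (X \<union> S))"
      using span_dim_insert[of "X \<union> S" e x] insert Sc S by auto
    finally show ?case by simp
  qed simp
  ultimately show ?thesis using T by simp
qed

section \<open>Spans and annihilators\<close>

lemma perp_span:
  fixes T :: "'a :: field vec set"
  assumes T: "T \<subseteq> carrier_vec e" and u: "u \<in> carrier_vec e" "\<forall>t \<in> T. t \<bullet> u = 0"
    and x: "x \<in> lin_span e T"
  shows "x \<bullet> u = 0"
proof -
  interpret vec_space "TYPE('a)" e .
  have "u \<bullet> t = 0" if "t \<in> T" for t
    using that u T comm_scalar_prod[OF u(1), of t] by (metis subsetD)
  then have "u \<in> orthogonal_complement T" unfolding orthogonal_complement_def using u by simp
  then have "u \<in> orthogonal_complement (span T)" by (simp only: in_orthogonal_complement_span[OF T])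
  then have "\<forall>y \<in> span T. u \<bullet> y = 0" by (simp add: orthogonal_complement_def)
  then have "u \<bullet> x = 0" using x by (rule bspec)
  then show ?thesis using comm_scalar_prod[OF u(1), of x] span_closed[OF T x] by simp
qed

text \<open>A linear functional vanishing on \<open>T\<close> but not at \<open>v\<close>, built by adding one vector of \<open>T\<close> at a
  time: a functional \<open>u\<close> that does not vanish at the new vector \<open>t\<close> is corrected by a multiple of
  one that separates \<open>t\<close> from the previous vectors.\<close>

lemma perp_separates:
  fixes T :: "'a :: field vec set"
  assumes "finite T" "T \<subseteq> carrier_vec e" "v \<in> carrier_vec e" "v \<notin> lin_span e T"
  shows "\<exists>u \<in> carrier_vec e. (\<forall>t \<in> T. t \<bullet> u = 0) \<and> v \<bullet> u \<noteq> 0"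
  using assms
proof (induction T arbitrary: v rule: finite_induct)
  case empty
  interpret vec_space "TYPE('a)" e .
  have "v \<noteq> 0\<^sub>v e" using empty by (auto simp: span_empty)
  then obtain i where i: "i < e" "v $ i \<noteq> 0" using empty(2) by (metis carrier_vecD eq_vecI index_zero_vec)
  have "v \<bullet> unit_vec e i \<noteq> 0" using i empty(2) by simp
  then show ?case by (intro bexI[of _ "unit_vec e i"]) auto
next
  case (insert t T)
  interpret vec_space "TYPE('a)" e .
  have T: "T \<subseteq> carrier_vec e" "finite T" and t: "t \<in> carrier_vec e" using insert by auto
  show ?case
  proof (cases "t \<in> span T")
    case True
    have "v \<notin> span T" using insert span_is_monotone[of T "insert t T"] by blast
    then obtain u where u: "u \<in> carrier_vec e" "\<forall>s \<in> T. s \<bullet> u = 0" "v \<bullet> u \<noteq> 0"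
      using insert.IH[OF T(1) insert.prems(2)] by metis
    have "t \<bullet> u = 0" by (rule perp_span[OF T(1) u(1,2) True])
    with u show ?thesis by auto
  next
    case False
    then obtain w where w: "w \<in> carrier_vec e" "\<forall>s \<in> T. s \<bullet> w = 0" "t \<bullet> w \<noteq> 0"
      using insert.IH[OF T(1) t] by metis
    \<comment> \<open>with this \<open>c\<close> the vector \<open>v - c t\<close> is orthogonal to \<open>w\<close>, so that the later correction by a
      multiple of \<open>w\<close> preserves its nonzero scalar product\<close>
    define c where "c = (v \<bullet> w) / (t \<bullet> w)"
    have v: "v \<in> carrier_vec e" by fact
    have "v - c \<cdot>\<^sub>v t \<notin> span T"
    proof
      assume a: "v - c \<cdot>\<^sub>v t \<in> span T"
      have ic: "insert t T \<subseteq> carrier_vec e" using T t by auto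
      have "v - c \<cdot>\<^sub>v t \<in> span (insert t T)" using a span_is_monotone[of T "insert t T"] by blast
      moreover have "c \<cdot>\<^sub>v t \<in> span (insert t T)" using smult_in_span[OF ic span_mem[OF ic]] by simp
      ultimately have "(v - c \<cdot>\<^sub>v t) + c \<cdot>\<^sub>v t \<in> span (insert t T)" using span_add1[OF ic] by blast
      moreover have "(v - c \<cdot>\<^sub>v t) + c \<cdot>\<^sub>v t = v" using v t by auto
      ultimately show False using insert by simp
    qed
    then obtain u where u: "u \<in> carrier_vec e" "\<forall>s \<in> T. s \<bullet> u = 0" "(v - c \<cdot>\<^sub>v t) \<bullet> u \<noteq> 0"
      using insert.IH[of "v - c \<cdot>\<^sub>v t"] T(1) t v
      by (metis minus_carrier_vec smult_carrier_vec)
    \<comment> \<open>correct \<open>u\<close> by a multiple of \<open>w\<close> so that it becomes orthogonal to \<open>t\<close> as well\<close>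
    define z where "z = u - ((t \<bullet> u) / (t \<bullet> w)) \<cdot>\<^sub>v w"
    have z: "x \<bullet> z = x \<bullet> u - (t \<bullet> u) / (t \<bullet> w) * (x \<bullet> w)" if "x \<in> carrier_vec e" for x
      unfolding z_def using that u w by (simp add: scalar_prod_minus_distrib)
    have "v \<bullet> z = (v - c \<cdot>\<^sub>v t) \<bullet> u"
      using z[OF v] v t u by (simp add: minus_scalar_prod_distrib c_def)
    moreover have "t \<bullet> z = 0" using z[OF t] w by simp
    moreover have "s \<bullet> z = 0" if "s \<in> T" for s using z[of s] that u w T by auto
    moreover have "z \<in> carrier_vec e" using u w by (simp add: z_def)
    ultimately show ?thesis using u(3) by (intro bexI[of _ z]) auto
  qed
qed

text \<open>Membership in a span is tested on its annihilator. This dual form turns every statement below about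
  spans into one about scalar products, where the transpose of \<open>B\<close> and sums of subfamilies are
  easily handled.\<close>

lemma in_span_iff_perp:
  fixes T :: "'a :: field vec set"
  assumes T: "finite T" "T \<subseteq> carrier_vec e" and x: "x \<in> carrier_vec e"
  shows "x \<in> lin_span e T \<longleftrightarrow> (\<forall>u \<in> carrier_vec e. (\<forall>t \<in> T. t \<bullet> u = 0) \<longrightarrow> x \<bullet> u = 0)"
  using perp_separates[OF T x] perp_span[OF T(2)] by metis

lemma lin_span_mono_perp:
  fixes S T :: "'a :: field vec set"
  assumes T: "finite T" "T \<subseteq> carrier_vec e" and S: "finite S" "S \<subseteq> carrier_vec e"
    and p: "\<And>u. u \<in> carrier_vec e \<Longrightarrow> (\<forall>t \<in> T. t \<bullet> u = 0) \<Longrightarrow> (\<forall>s \<in> S. s \<bullet> u = 0)"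
  shows "lin_span e S \<subseteq> lin_span e T"
proof
  interpret vec_space "TYPE('a)" e .
  fix x assume x: "x \<in> span S"
  have xc: "x \<in> carrier_vec e" using span_closed[OF S(2) x] .
  show "x \<in> span T" using x in_span_iff_perp[OF T xc] in_span_iff_perp[OF S xc] p by blast
qed

lemma span_dim_eq_perp:
  fixes S T :: "'a :: field vec set"
  assumes "finite T" "T \<subseteq> carrier_vec e" "finite S" "S \<subseteq> carrier_vec e"
    and "\<And>u. u \<in> carrier_vec e \<Longrightarrow> (\<forall>t \<in> T. t \<bullet> u = 0) \<longleftrightarrow> (\<forall>s \<in> S. s \<bullet> u = 0)"
  shows "span_dim e S = span_dim e T"
  using lin_span_mono_perp[of T e S] lin_span_mono_perp[of S e T] assms by (intro span_dim_cong) blast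

section \<open>Row rank and column rank\<close>

text \<open>A basis of the row space with \<open>k\<close> elements factors \<open>A\<close> through a space of dimension \<open>k\<close>, so the
  columns lie in a span of \<open>k\<close> vectors. Applied to the transpose this gives the reverse inequality.\<close>

lemma span_dim_cols_le_rows:
  fixes A :: "'a :: field mat"
  assumes A: "A \<in> carrier_mat nr nc"
  shows "span_dim nr (set (cols A)) \<le> span_dim nc (set (rows A))"
proof -
  interpret vec_space "TYPE('a)" nc .
  have rA: "set (rows A) \<subseteq> carrier_vec nc" using A rows_carrier by blast
  obtain U where U: "U \<subseteq> set (rows A)" "span U = span (set (rows A))"
    "span_dim nc (set (rows A)) = card U"
    by (rule indpt_subset_basis[OF rA finite_set])
  have Uc: "U \<subseteq> carrier_vec nc" and fU: "finite U" using U(1) rA finite_subset by blast+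
  have "\<exists>c. row A i = lincomb c U" if "i < nr" for i
  proof -
    have "row A i \<in> set (rows A)" using that A by (auto simp: rows_def)
    then have "row A i \<in> span U" using U(2) rA span_mem by blast
    then show ?thesis using finite_in_span[OF fU Uc, of "row A i"] by metis
  qed
  then obtain c where c: "\<And>i. i < nr \<Longrightarrow> row A i = lincomb (c i) U" by metis
  \<comment> \<open>a factorization of \<open>A\<close> through its row space: \<open>w t\<close> is the column of coefficients of \<open>t\<close>\<close>
  define w where "w t = vec nr (\<lambda>i. c i t)" for t
  have wc: "finite (w ` U)" "w ` U \<subseteq> carrier_vec nr" using fU by (auto simp: w_def)
  have "set (cols A) \<subseteq> lin_span nr (w ` U)"
  proof
    fix x assume "x \<in> set (cols A)"
    then obtain l where l: "l < nc" "x = col A l" using A by (auto simp: cols_def)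
    have x: "x \<in> carrier_vec nr" using l A by auto
    have "x \<bullet> y = 0" if y: "y \<in> carrier_vec nr" "\<forall>t \<in> w ` U. t \<bullet> y = 0" for y
    proof -
      have ent: "x $ i = (\<Sum>t\<in>U. c i t * t $ l)" if i: "i < nr" for i
      proof -
        have "x $ i = row A i $ l" using l A i by simp
        then show ?thesis using c[OF i] lincomb_index[OF l(1) Uc] by simp
      qed
      have "x \<bullet> y = (\<Sum>i<nr. (\<Sum>t\<in>U. c i t * t $ l) * y $ i)"
        using y(1) ent by (simp add: scalar_prod_def atLeast0LessThan)
      also have "\<dots> = (\<Sum>t\<in>U. \<Sum>i<nr. c i t * t $ l * y $ i)"
        by (simp add: sum_distrib_right sum.swap[of _ U])
      also have "\<dots> = (\<Sum>t\<in>U. t $ l * (w t \<bullet> y))"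
        using y(1) by (intro sum.cong refl)
          (simp add: scalar_prod_def atLeast0LessThan w_def sum_distrib_left algebra_simps)
      finally show ?thesis using y(2) by simp
    qed
    then show "x \<in> lin_span nr (w ` U)" using in_span_iff_perp[OF wc x] by blast
  qed
  then have "span_dim nr (set (cols A)) \<le> span_dim nr (w ` U)" using wc by (intro span_dim_mono) auto
  also have "\<dots> \<le> card U" using span_dim_le_card[OF wc(2,1)] card_image_le[OF fU, of w] by linarith
  finally show ?thesis using U(3) by simp
qed

lemma rank_eq_span_dim_rows:
  fixes A :: "'a :: field mat"
  assumes A: "A \<in> carrier_mat nr nc"
  shows "vec_space.rank nr A = span_dim nc (set (rows A))"
proof -
  have "vec_space.rank nr A = span_dim nr (set (cols A))"
    by (simp add: vec_space.rank_def span_dim_def)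
  moreover have "span_dim nc (set (rows A)) \<le> span_dim nr (set (cols A))"
    using span_dim_cols_le_rows[of "A\<^sup>T" nc nr] A by simp
  ultimately show ?thesis using span_dim_cols_le_rows[OF A] by simp
qed

section \<open>Flats and non-splitting flags\<close>

lemma row_image_carrier: "row B ` C \<subseteq> carrier_vec (dim_col B)"
  by auto

lemma fam_sum_closed: "fam_sum B C \<in> carrier_vec (dim_col B)"
proof -
  interpret vec_space "TYPE('a)" "dim_col B" .
  show ?thesis unfolding fam_sum_def finsum_vec by (rule finsum_closed) auto
qed

lemma fam_sum_scalar_prod:
  assumes "u \<in> carrier_vec (dim_col B)"
  shows "fam_sum B C \<bullet> u = (\<Sum>i\<in>C. row B i \<bullet> u)"
proof -
  interpret vec_space "TYPE('a)" "dim_col B" .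
  show ?thesis unfolding fam_sum_def finsum_vec
    using assms by (intro finsum_scalar_prod_sum) auto
qed

lemma in_fam_span_iff:
  assumes "finite C" "x \<in> carrier_vec (dim_col B)"
  shows "x \<in> fam_span B C \<longleftrightarrow>
    (\<forall>u \<in> carrier_vec (dim_col B). (\<forall>i \<in> C. row B i \<bullet> u = 0) \<longrightarrow> x \<bullet> u = 0)"
  unfolding fam_span_def using in_span_iff_perp[OF _ row_image_carrier assms(2), of C] assms(1) by simp

lemma fam_span_mono_perp:
  assumes "finite C" "finite D"
    and "\<And>u. u \<in> carrier_vec (dim_col B) \<Longrightarrow> \<forall>i \<in> D. row B i \<bullet> u = 0 \<Longrightarrow> \<forall>i \<in> C. row B i \<bullet> u = 0"
  shows "fam_span B C \<subseteq> fam_span B D"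
  unfolding fam_span_def using assms by (intro lin_span_mono_perp row_image_carrier) auto

lemma fam_rank_cong: "fam_span B C = fam_span B D \<Longrightarrow> fam_rank B C = fam_rank B D"
  unfolding fam_rank_def fam_span_def by (rule span_dim_cong)

lemma fam_rank_insert:
  assumes "finite C"
  shows "fam_rank B (insert i C) = fam_rank B C + (if row B i \<in> fam_span B C then 0 else 1)"
  unfolding fam_rank_def fam_span_def image_insert
  using assms by (intro span_dim_insert row_image_carrier) auto

lemma flat_subset: "flat B F \<Longrightarrow> F \<subseteq> {..<dim_row B}"
  by (simp add: flat_def)

lemma flat_finite: "flat B F \<Longrightarrow> finite F"
  using flat_subset finite_subset by blast

definition flat_closure :: "'a :: field mat \<Rightarrow> nat set \<Rightarrow> nat set" where
  "flat_closure B C = {i. i < dim_row B \<and> row B i \<in> fam_span B C}"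

lemma
  assumes C: "C \<subseteq> {..<dim_row B}"
  shows subset_flat_closure: "C \<subseteq> flat_closure B C"
    and fam_span_flat_closure: "fam_span B (flat_closure B C) = fam_span B C"
    and flat_flat_closure: "flat B (flat_closure B C)"
proof -
  have fC: "finite C" using C finite_subset by blast
  have fcl: "finite (flat_closure B C)" by (simp add: flat_closure_def)
  show sub: "C \<subseteq> flat_closure B C"
  proof
    fix i assume i: "i \<in> C"
    then have "row B i \<in> fam_span B C" using in_fam_span_iff[OF fC, of "row B i" B] by simp
    then show "i \<in> flat_closure B C" using i C by (auto simp: flat_closure_def)
  qed
  have perp: "(\<forall>i \<in> C. row B i \<bullet> u = 0) \<longleftrightarrow> (\<forall>i \<in> flat_closure B C. row B i \<bullet> u = 0)"
    if u: "u \<in> carrier_vec (dim_col B)" for u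
  proof
    assume p: "\<forall>i \<in> C. row B i \<bullet> u = 0"
    show "\<forall>i \<in> flat_closure B C. row B i \<bullet> u = 0"
    proof
      fix i assume "i \<in> flat_closure B C"
      then have "row B i \<in> fam_span B C" by (simp add: flat_closure_def)
      then show "row B i \<bullet> u = 0" using in_fam_span_iff[OF fC, of "row B i" B] p u by simp
    qed
  qed (use sub in blast)
  show eq: "fam_span B (flat_closure B C) = fam_span B C"
    using fam_span_mono_perp[OF fC fcl] fam_span_mono_perp[OF fcl fC] perp by (metis subset_antisym)
  show "flat B (flat_closure B C)"
    unfolding flat_def eq by (auto simp: flat_closure_def)
qed

lemma flat_closure_subset:
  assumes E: "flat B E" and CE: "C \<subseteq> E"
  shows "flat_closure B C \<subseteq> E"
proof
  fix i assume "i \<in> flat_closure B C"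
  then have i: "i < dim_row B" "row B i \<in> fam_span B C" by (auto simp: flat_closure_def)
  have "fam_span B C \<subseteq> fam_span B E"
    using fam_span_mono_perp[of C E] CE flat_finite[OF E] finite_subset by blast
  then show "i \<in> E" using i E unfolding flat_def by blast
qed

text \<open>Modulo \<open>L(F)\<close> the sum of \<open>E\<close> is the sum of the \<open>s(G)\<close>, where \<open>G\<close> runs over the flats that cover
  \<open>F\<close> inside \<open>E\<close>, as the sets \<open>G - F\<close> partition \<open>E - F\<close>. So they cannot all satisfy \<open>s(G) \<in> L(F)\<close>.\<close>

lemma flat_grow:
  assumes F: "flat B F" and E: "flat B E" and FE: "F \<subseteq> E"
    and s: "fam_sum B E \<notin> fam_span B F"
  obtains G where "flat B G" "F \<subset> G" "G \<subseteq> E" "fam_rank B G = fam_rank B F + 1"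
    "fam_sum B G \<notin> fam_span B F"
proof -
  define G where "G i = flat_closure B (insert i F)" for i
  note fF = flat_finite[OF F] and fE = flat_finite[OF E]
  have ins: "insert i F \<subseteq> {..<dim_row B}" if "i \<in> E" for i
    using that FE flat_subset[OF E] by blast
  have notin: "row B i \<notin> fam_span B F" if "i \<in> E - F" for i
    using that F flat_subset[OF E] unfolding flat_def by blast
  have GE: "G i \<subseteq> E" if "i \<in> E" for i
    unfolding G_def using that FE by (intro flat_closure_subset[OF E]) auto
  have iG: "insert i F \<subseteq> G i" if "i \<in> E" for i
    unfolding G_def using subset_flat_closure[OF ins[OF that]] .
  have rank: "fam_rank B (G i) = fam_rank B F + 1" if i: "i \<in> E - F" for i
  proof -
    have "fam_rank B (G i) = fam_rank B (insert i F)"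
      unfolding G_def using i by (intro fam_rank_cong fam_span_flat_closure ins) blast
    then show ?thesis using fam_rank_insert[OF fF, of B i] notin[OF i] by simp
  qed
  have memG: "j \<in> G i \<longleftrightarrow> row B j \<in> fam_span B (insert i F)" if "j \<in> E" for i j
    unfolding G_def flat_closure_def using that flat_subset[OF E] by blast
  \<comment> \<open>exchange, by computing the rank of \<open>F \<union> {i, j}\<close> in both orders: the sets \<open>G i - F\<close> are
    the classes of an equivalence relation on \<open>E - F\<close>\<close>
  have class_eq: "G j = G i" if i: "i \<in> E - F" and j: "j \<in> E - F" and ji: "j \<in> G i" for i j
  proof -
    have "fam_rank B (insert i (insert j F)) = fam_rank B F + 1"
      using fam_rank_insert[of "insert i F" B j] fam_rank_insert[OF fF, of B i] notin[OF i]
        ji memG[of j i] j fF by (simp add: insert_commute)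
    then have ij: "row B i \<in> fam_span B (insert j F)"
      using fam_rank_insert[of "insert j F" B i] fam_rank_insert[OF fF, of B j] notin[OF j] fF
      by (auto split: if_splits)
    have "G j \<subseteq> G i" unfolding G_def[of j]
      using ji iG[of i] i by (intro flat_closure_subset) (auto simp: G_def intro!: flat_flat_closure ins)
    moreover have "G i \<subseteq> G j" unfolding G_def[of i]
      using ij memG[of i j] iG[of j] i j
      by (intro flat_closure_subset) (auto simp: G_def intro!: flat_flat_closure ins)
    ultimately show ?thesis by blast
  qed
  have "\<exists>i \<in> E - F. fam_sum B (G i) \<notin> fam_span B F"
  proof (rule ccontr)
    assume "\<not> ?thesis"
    then have all: "fam_sum B (G i) \<in> fam_span B F" if "i \<in> E - F" for i using that by blast
    have "fam_sum B E \<bullet> u = 0"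
      if u: "u \<in> carrier_vec (dim_col B)" and p: "\<forall>i \<in> F. row B i \<bullet> u = 0" for u
    proof -
      let ?f = "\<lambda>i. row B i \<bullet> u"
      have cls: "(\<Sum>j \<in> {j \<in> E - F. G j = H}. ?f j) = 0" if H: "H \<in> G ` (E - F)" for H
      proof -
        obtain i where i: "i \<in> E - F" "H = G i" using H by blast
        have eq: "{j \<in> E - F. G j = H} = G i - F"
          using class_eq[OF i(1)] iG GE i by blast
        have "fam_sum B (G i) \<bullet> u = 0"
          using all[OF i(1)] in_fam_span_iff[OF fF fam_sum_closed] u p by blast
        then have "(\<Sum>j\<in>G i. ?f j) = 0" using fam_sum_scalar_prod[OF u] by simp
        moreover have "(\<Sum>j\<in>G i. ?f j) = (\<Sum>j\<in>G i - F. ?f j) + (\<Sum>j\<in>F. ?f j)"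
          using iG[of i] GE[of i] i fE finite_subset by (intro sum.subset_diff) auto
        ultimately show ?thesis using p eq by simp
      qed
      have "fam_sum B E \<bullet> u = (\<Sum>j\<in>E. ?f j)" using fam_sum_scalar_prod[OF u] .
      also have "\<dots> = (\<Sum>j\<in>E - F. ?f j) + (\<Sum>j\<in>F. ?f j)" using FE fE by (intro sum.subset_diff)
      also have "(\<Sum>j\<in>F. ?f j) = 0" using p by simp
      also have "(\<Sum>j\<in>E - F. ?f j) = (\<Sum>H\<in>G ` (E - F). \<Sum>j \<in> {j \<in> E - F. G j = H}. ?f j)"
        using fE by (intro sum.group[symmetric]) auto
      also have "\<dots> = 0" using cls by (intro sum.neutral) blast
      finally show ?thesis by simp
    qed
    then have "fam_sum B E \<in> fam_span B F" using in_fam_span_iff[OF fF fam_sum_closed] by blast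
    with s show False ..
  qed
  then obtain i where i: "i \<in> E - F" "fam_sum B (G i) \<notin> fam_span B F" by blast
  show thesis
  proof (rule that[of "G i"])
    show "flat B (G i)" unfolding G_def using i by (intro flat_flat_closure ins) blast
    show "F \<subset> G i" using iG[of i] i by blast
    show "G i \<subseteq> E" using GE i by blast
  qed (use rank i in auto)
qed

text \<open>The empty flag is regarded as ending in the flat of rank \<open>0\<close>, whose span is zero. The conditions
  on the first and on a later member of a non-splitting flag then become the same condition.\<close>

definition nonsplitting_flag_to :: "'a :: field mat \<Rightarrow> nat set \<Rightarrow> nat set list \<Rightarrow> bool" where
  "nonsplitting_flag_to B F Fs \<longleftrightarrow> flag B Fs \<and> non_splitting B Fs \<and> flat B F \<and>
     fam_rank B F = length Fs \<and> (Fs \<noteq> [] \<longrightarrow> last Fs = F)"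

lemma nonsplitting_flag_to_empty: "nonsplitting_flag_to B (flat_closure B {}) []"
proof -
  have "fam_rank B (flat_closure B {}) = fam_rank B {}"
    by (intro fam_rank_cong fam_span_flat_closure) simp
  then show ?thesis
    by (simp add: nonsplitting_flag_to_def flag_def non_splitting_def flat_flat_closure
        fam_rank_def span_dim_empty)
qed

lemma nonsplitting_flag_to_snoc:
  assumes Fs: "nonsplitting_flag_to B F Fs" and G: "flat B G" "F \<subset> G"
    "fam_rank B G = fam_rank B F + 1" "fam_sum B G \<notin> fam_span B F"
  shows "nonsplitting_flag_to B G (Fs @ [G])"
proof -
  have *: "flag B Fs" "non_splitting B Fs" "fam_rank B F = length Fs" "Fs \<noteq> [] \<Longrightarrow> last Fs = F"
    using Fs by (auto simp: nonsplitting_flag_to_def)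
  have below: "H \<subset> G" if H: "H \<in> set Fs" for H
  proof -
    have ne: "Fs \<noteq> []" using H by auto
    then obtain Gs where Gs: "Fs = Gs @ [F]" using *(4) append_butlast_last_id by metis
    then have "H = F \<or> H \<subset> F" using *(1) H by (auto simp: flag_def sorted_wrt_append)
    then show ?thesis using G(2) by blast
  qed
  have "flag B (Fs @ [G])"
    using *(1,3) G(1,3) below unfolding flag_def
    by (auto simp: sorted_wrt_append nth_append less_Suc_eq)
  moreover have "non_splitting B (Fs @ [G])"
  proof -
    have "fam_sum B G \<notin> fam_span B (Fs ! j)" if "j + 1 = length Fs" for j
    proof -
      have "Fs \<noteq> []" using that by auto
      moreover have "j = length Fs - 1" using that by simp
      ultimately have "Fs ! j = F" using *(4) by (simp add: last_conv_nth)
      then show ?thesis using G(4) by simp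
    qed
    moreover have "fam_sum B G \<noteq> 0\<^sub>v (dim_col B)" 
    proof
      assume "fam_sum B G = 0\<^sub>v (dim_col B)"
      then have "fam_sum B G \<in> fam_span B F"
        using in_fam_span_iff[OF flat_finite, of B F "fam_sum B G"] Fs
        by (simp add: nonsplitting_flag_to_def)
      then show False using G(4) by simp
    qed
    ultimately show ?thesis
      using *(2) unfolding non_splitting_def
      by (cases "Fs = []") (auto simp: nth_append less_Suc_eq)
  qed
  ultimately show ?thesis using G(1,3) *(3) by (simp add: nonsplitting_flag_to_def)
qed

text \<open>The greedy construction: either the first flat of the chain is dropped, or the flag grows inside it.
  The length of the chain plus the number \<open>dim_row B - card F\<close> of indices outside \<open>F\<close>
  decreases in both cases.\<close>

lemma nonsplitting_flag_from_chain:
  assumes "nonsplitting_flag_to B F Fs"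
    and "sorted_wrt (\<subseteq>) Es" "\<forall>E \<in> set Es. flat B E \<and> F \<subseteq> E"
  shows "\<exists>Gs. flag B Gs \<and> non_splitting B Gs \<and>
    span_dim (dim_col B) (row B ` F \<union> fam_sum B ` set Es) \<le> length Gs"
  using assms
proof (induction "length Es + (dim_row B - card F)" arbitrary: F Fs Es rule: less_induct)
  case less
  have F: "flat B F" and rF: "fam_rank B F = length Fs" and fl: "flag B Fs" "non_splitting B Fs"
    using less.prems(1) by (auto simp: nonsplitting_flag_to_def)
  show ?case
  proof (cases Es)
    case Nil
    then show ?thesis using fl rF by (auto simp: fam_rank_def)
  next
    case (Cons E Es')
    have E: "flat B E" "F \<subseteq> E" and Es': "sorted_wrt (\<subseteq>) Es'" "\<forall>E' \<in> set Es'. flat B E' \<and> F \<subseteq> E'"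
      and EE: "\<forall>E' \<in> set Es'. E \<subseteq> E'"
      using less.prems(2,3) Cons by auto
    let ?S = "\<lambda>F Es. row B ` F \<union> fam_sum B ` set Es"
    have finS: "finite (?S H Ds)" if "flat B H" for H Ds using flat_finite[OF that] by simp
    have car: "?S H Ds \<subseteq> carrier_vec (dim_col B)" for H Ds using fam_sum_closed by auto
    show ?thesis
    proof (cases "fam_sum B E \<in> fam_span B F")
      case True
      have "fam_sum B E \<in> lin_span (dim_col B) (?S F Es')"
        using True lin_span_mono[of "row B ` F" "?S F Es'"] unfolding fam_span_def by blast
      then have "span_dim (dim_col B) (?S F Es) = span_dim (dim_col B) (?S F Es')"
        using span_dim_insert[OF car finS[OF F] fam_sum_closed, of E Es'] Cons by simp
      moreover have "length Es' + (dim_row B - card F) < length Es + (dim_row B - card F)"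
        using Cons by simp
      ultimately show ?thesis using less.hyps[OF _ less.prems(1) Es'] by simp
    next
      case False
      obtain G where G: "flat B G" "F \<subset> G" "G \<subseteq> E" "fam_rank B G = fam_rank B F + 1"
        "fam_sum B G \<notin> fam_span B F"
        using flat_grow[OF F E False] .
      have "card F < card G" using G(2) flat_finite[OF G(1)] by (rule psubset_card_mono[rotated])
      moreover have "card G \<le> dim_row B" using card_mono[OF _ flat_subset[OF G(1)]] by simp
      ultimately have "length Es + (dim_row B - card G) < length Es + (dim_row B - card F)" by simp
      moreover have "\<forall>E' \<in> set Es. flat B E' \<and> G \<subseteq> E'" using Cons G(3) EE less.prems(3) by auto
      ultimately obtain Gs where Gs: "flag B Gs" "non_splitting B Gs"
        "span_dim (dim_col B) (?S G Es) \<le> length Gs"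
        using less.hyps[OF _ nonsplitting_flag_to_snoc[OF less.prems(1) G(1,2,4,5)] less.prems(2)]
        by blast
      have "?S F Es \<subseteq> ?S G Es" using G(2) by blast
      then have "?S F Es \<subseteq> lin_span (dim_col B) (?S G Es)"
        using subset_lin_span[OF car] by (rule subset_trans)
      then have "span_dim (dim_col B) (?S F Es) \<le> span_dim (dim_col B) (?S G Es)"
        using span_dim_mono[OF car finS[OF G(1)]] finS[OF F] by simp
      with Gs show ?thesis using le_trans by blast
    qed
  qed
qed

text \<open>Triangularity: the sums of the first \<open>k\<close> members lie in the span of the \<open>k\<close>-th member, which does not
  contain the next sum.\<close>

lemma span_dim_nonsplitting_sums:
  assumes fl: "flag B Fs" and ns: "non_splitting B Fs"
  shows "span_dim (dim_col B) (fam_sum B ` set Fs) = length Fs"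
proof -
  let ?e = "dim_col B"
  have flatF: "flat B (Fs ! j)" if "j < length Fs" for j using fl that by (simp add: flag_def)
  have car: "fam_sum B ` X \<subseteq> carrier_vec ?e" for X using fam_sum_closed by blast
  have new: "fam_sum B (Fs ! k) \<notin> lin_span ?e (fam_sum B ` set (take k Fs))" if k: "k < length Fs" for k
  proof (cases k)
    case 0
    interpret vec_space "TYPE('a)" ?e .
    show ?thesis using 0 ns k by (auto simp: non_splitting_def span_empty)
  next
    case (Suc j)
    have j: "j < length Fs" using Suc k by simp
    have "fam_sum B ` set (take k Fs) \<subseteq> fam_span B (Fs ! j)"
    proof
      fix x assume "x \<in> fam_sum B ` set (take k Fs)"
      then obtain i where i: "i < k" "i < length Fs" "x = fam_sum B (Fs ! i)"
        by (auto simp: in_set_conv_nth)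
      have "Fs ! i \<subseteq> Fs ! j"
        using fl sorted_wrt_nth_less[of "(\<subset>)" Fs i j] i(1) j Suc
        by (cases "i = j") (auto simp: flag_def)
      then have "x \<bullet> u = 0" if u: "u \<in> carrier_vec ?e" "\<forall>l \<in> Fs ! j. row B l \<bullet> u = 0" for u
        unfolding i(3) fam_sum_scalar_prod[OF u(1)] using u(2) by (intro sum.neutral) blast
      then show "x \<in> fam_span B (Fs ! j)"
        using in_fam_span_iff[OF flat_finite[OF flatF[OF j]] fam_sum_closed] i(3) by blast
    qed
    then have "lin_span ?e (fam_sum B ` set (take k Fs)) \<subseteq> fam_span B (Fs ! j)"
      unfolding fam_span_def by (rule lin_span_least[OF row_image_carrier])
    then show ?thesis using ns k Suc by (auto simp: non_splitting_def)
  qed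
  have "span_dim ?e (fam_sum B ` set (take k Fs)) = k" if "k \<le> length Fs" for k
    using that
  proof (induction k)
    case 0
    show ?case by (simp add: span_dim_empty)
  next
    case (Suc k)
    then have k: "k < length Fs" by simp
    have "fam_sum B ` set (take (Suc k) Fs) = insert (fam_sum B (Fs ! k)) (fam_sum B ` set (take k Fs))"
      by (simp add: take_Suc_conv_app_nth[OF k])
    then show ?case
      using span_dim_insert[OF car _ fam_sum_closed, of "set (take k Fs)" "Fs ! k"] new[OF k] Suc.IH k
      by simp
  qed
  from this[of "length Fs"] show ?thesis by simp
qed

lemma length_flag_le:
  assumes fl: "flag B Fs"
  shows "length Fs \<le> dim_row B"
proof (cases "Fs = []")
  case False
  define F where "F = Fs ! (length Fs - 1)"
  have F: "flat B F" "fam_rank B F = length Fs" using fl False by (auto simp: flag_def F_def)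
  have "fam_rank B F \<le> card (row B ` F)" unfolding fam_rank_def
    using flat_finite[OF F(1)] by (intro span_dim_le_card row_image_carrier) auto
  also have "\<dots> \<le> card F" using card_image_le[OF flat_finite[OF F(1)]] .
  also have "\<dots> \<le> dim_row B" using card_mono[OF _ flat_subset[OF F(1)]] by simp
  finally show ?thesis using F(2) by simp
qed simp

section \<open>Supports of kernel vectors and flats of a Gale dual\<close>

lemma flat_zero_set:
  assumes u: "u \<in> carrier_vec (dim_col B)"
  shows "flat B {i. i < dim_row B \<and> row B i \<bullet> u = 0}" (is "flat B ?Z")
  unfolding flat_def
proof (intro conjI allI impI)
  fix i assume i: "i < dim_row B" "row B i \<in> fam_span B ?Z"
  then show "i \<in> ?Z" using in_fam_span_iff[of ?Z "row B i" B] u by auto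
qed auto

text \<open>Each row outside \<open>F\<close> is nonzero at some vector orthogonal to \<open>F\<close>; as the field is infinite,
  suitable linear combinations of these vectors avoid the finitely many hyperplanes
  orthogonal to the rows outside \<open>F\<close>.\<close>

lemma flat_is_zero_set:
  fixes B :: "'k :: field_char_0 mat"
  assumes F: "flat B F"
  obtains u where "u \<in> carrier_vec (dim_col B)" "{i. i < dim_row B \<and> row B i \<bullet> u = 0} = F"
proof -
  let ?e = "dim_col B"
  have "\<exists>u \<in> carrier_vec ?e. (\<forall>i \<in> F. row B i \<bullet> u = 0) \<and> (\<forall>j \<in> J. row B j \<bullet> u \<noteq> 0)"
    if "finite J" "J \<subseteq> {..<dim_row B} - F" for J
    using that
  proof (induction J rule: finite_induct)
    case empty
    show ?case by (intro bexI[of _ "0\<^sub>v ?e"]) auto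
  next
    case (insert i J)
    then obtain u where u: "u \<in> carrier_vec ?e" "\<forall>i \<in> F. row B i \<bullet> u = 0" "\<forall>j \<in> J. row B j \<bullet> u \<noteq> 0"
      by auto
    have "row B i \<notin> fam_span B F" using insert.prems F by (auto simp: flat_def)
    then obtain w where w: "w \<in> carrier_vec ?e" "\<forall>i \<in> F. row B i \<bullet> w = 0" "row B i \<bullet> w \<noteq> 0"
      using in_fam_span_iff[OF flat_finite[OF F], of "row B i"] by auto
    \<comment> \<open>for each \<open>j\<close>, at most one multiple of \<open>w\<close> makes the scalar product with row \<open>j\<close> vanish\<close>
    have "finite ((\<lambda>j. - (row B j \<bullet> u) / (row B j \<bullet> w)) ` insert i J)" using insert.hyps by simp
    then obtain c where c: "c \<notin> (\<lambda>j. - (row B j \<bullet> u) / (row B j \<bullet> w)) ` insert i J"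
      using ex_new_if_finite[OF infinite_UNIV_char_0] by blast
    define z where "z = u + c \<cdot>\<^sub>v w"
    have z: "row B j \<bullet> z = row B j \<bullet> u + c * (row B j \<bullet> w)" for j
      unfolding z_def using u w by (simp add: scalar_prod_add_distrib[of _ ?e])
    have "row B j \<bullet> z \<noteq> 0" if j: "j \<in> insert i J" for j
    proof (cases "row B j \<bullet> w = 0")
      case True
      then show ?thesis using z[of j] u(3) w(3) j by auto
    next
      case False
      have "c \<noteq> - (row B j \<bullet> u) / (row B j \<bullet> w)" using c j by blast
      then show ?thesis using z[of j] False by (simp add: field_simps add_eq_0_iff)
    qed
    moreover have "z \<in> carrier_vec ?e" using u w by (simp add: z_def)
    ultimately show ?case using u w z by (intro bexI[of _ z]) auto
  qed
  from this[of "{..<dim_row B} - F"] obtain u where u: "u \<in> carrier_vec ?e"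
    "\<forall>i \<in> F. row B i \<bullet> u = 0" "\<forall>j \<in> {..<dim_row B} - F. row B j \<bullet> u \<noteq> 0" by auto
  have "{i. i < dim_row B \<and> row B i \<bullet> u = 0} = F" using u flat_subset[OF F] by auto
  with u(1) show thesis by (rule that)
qed

lemma mat_kernel_gale_dual:
  assumes A: "A \<in> carrier_mat r n" and g: "gale_dual A B"
  shows "B \<in> carrier_mat n (dim_col B)"
    and "mat_kernel A = {B *\<^sub>v u | u. u \<in> carrier_vec (dim_col B)}"
proof -
  interpret kernel r n A by (unfold_locales) (rule A)
  have b: "dim_row B = n" "basis (set (cols B))" using g A by (auto simp: gale_dual_def)
  show B: "B \<in> carrier_mat n (dim_col B)" using b by auto
  have sub: "set (cols B) \<subseteq> mat_kernel A" and sp: "span (set (cols B)) = mat_kernel A"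
    using b(2) unfolding Ker.basis_def by auto
  have "mat_kernel A = NC.col_space B" using span_same[OF sub] sp by (simp add: NC.col_space_def)
  also have "\<dots> = {B *\<^sub>v u | u. u \<in> carrier_vec (dim_col B)}"
    unfolding NC.col_space_eq[OF B] using b(1) mult_mat_vec_carrier[OF B] by auto
  finally show "mat_kernel A = {B *\<^sub>v u | u. u \<in> carrier_vec (dim_col B)}" .
qed

section \<open>The rank of a homogeneous configuration\<close>

text \<open>The direction space of an affine span is an infinite set of differences, while the dimension
  formulas above are for finite sets; this lemma connects the two.\<close>

lemma finite_subset_spanning:
  fixes S :: "'a :: field vec set"
  assumes S: "S \<subseteq> carrier_vec e"
  obtains T where "T \<subseteq> S" "finite T" "lin_span e T = lin_span e S"
proof -
  let ?P = "\<lambda>T. finite T \<and> T \<subseteq> S"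
  have bound: "span_dim e T \<le> e" if T: "?P T" for T
  proof -
    interpret vec_space "TYPE('a)" e .
    have sub: "T \<subseteq> span (set (unit_vecs e))"
      using T S by (simp only: span_unit_vecs_is_carrier) blast
    have "span_dim e T \<le> span_dim e (set (unit_vecs e :: 'a vec list))"
      using sub T by (intro span_dim_mono unit_vecs_carrier) auto
    also have "\<dots> \<le> card (set (unit_vecs e :: 'a vec list))"
      by (intro span_dim_le_card unit_vecs_carrier) auto
    also have "\<dots> \<le> e" using card_length[of "unit_vecs e :: 'a vec list"] by simp
    finally show ?thesis .
  qed
  have "?P {}" by simp
  then obtain T where T: "?P T" and max: "\<And>T'. ?P T' \<Longrightarrow> span_dim e T' \<le> span_dim e T"
    using ex_has_greatest_nat[of ?P "{}" "span_dim e" "Suc e"] bound by (metis less_Suc_eq_le)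
  have Tc: "T \<subseteq> carrier_vec e" "finite T" using T S by auto
  have "S \<subseteq> lin_span e T"
  proof
    fix s assume s: "s \<in> S"
    have "span_dim e (insert s T) \<le> span_dim e T" using max[of "insert s T"] T s by simp
    moreover have "s \<in> carrier_vec e" using s S by blast
    ultimately show "s \<in> lin_span e T" using span_dim_insert[OF Tc, of s] by (auto split: if_splits)
  qed
  then have "lin_span e S \<subseteq> lin_span e T" by (rule lin_span_least[OF Tc(1)])
  moreover have "lin_span e T \<subseteq> lin_span e S" using T by (intro lin_span_mono) simp
  ultimately show thesis using that[of T] T by blast
qed

text \<open>If \<open>x = w\<^sup>T A\<close>, then \<open>w \<bullet> (A c) = x \<bullet> c\<close>. For \<open>x = (1, \<dots>, 1)\<close> the vector \<open>w\<close> takes the value \<open>1\<close>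
  at every point of the configuration.\<close>

lemma row_space_functional:
  fixes A :: "'a :: field mat"
  assumes A: "A \<in> carrier_mat r n" and x: "x \<in> vec_space.row_space n A"
  obtains w where "w \<in> carrier_vec r" "\<And>c. c \<in> carrier_vec n \<Longrightarrow> w \<bullet> (A *\<^sub>v c) = x \<bullet> c"
proof -
  interpret vec_space "TYPE('a)" n .
  obtain w where w: "w \<in> carrier_vec r" "A\<^sup>T *\<^sub>v w = x"
    using x row_space_eq[OF A] A by auto
  have "w \<bullet> (A *\<^sub>v c) = x \<bullet> c" if "c \<in> carrier_vec n" for c
    using transpose_vec_mult_scalar[OF A that w(1)] w(2) by simp
  with w(1) show thesis by (rule that)
qed

text \<open>Homogeneity gives \<open>w\<close> with \<open>w \<bullet> x = 1\<close> on the affine span. It vanishes on the direction space, of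
  dimension \<open>d\<close>, and not at a point of the affine span; this point is therefore one further
  independent vector of the column space.\<close>

lemma affine_dim_less_rank:
  fixes A :: "'a :: field mat"
  assumes A: "A \<in> carrier_mat r n" and h: "homogeneous A" and d: "affine_dim A = int d"
  shows "d < vec_space.rank r A"
proof -
  let ?D = "{x - y | x y. x \<in> affine_span A \<and> y \<in> affine_span A}"
  have ne: "affine_span A \<noteq> {}" and dim: "span_dim r ?D = d"
    using d A by (auto simp: affine_dim_def split: if_splits)
  obtain w where w: "w \<in> carrier_vec r"
    "\<And>c. c \<in> carrier_vec n \<Longrightarrow> w \<bullet> (A *\<^sub>v c) = vec n (\<lambda>_. 1) \<bullet> c"
    using row_space_functional[OF A, of "vec n (\<lambda>_. 1)"] h A by (auto simp: homogeneous_def)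
  have aff: "x \<in> lin_span r (set (cols A)) \<and> x \<in> carrier_vec r \<and> x \<bullet> w = 1"
    if x: "x \<in> affine_span A" for x
  proof -
    interpret vec_space "TYPE('a)" r .
    obtain c where c: "x = A *\<^sub>v c" "c \<in> carrier_vec n" "(\<Sum>i<n. c $ i) = 1"
      using x A by (auto simp: affine_span_def)
    have xc: "x \<in> carrier_vec r" using c A by simp
    have "vec n (\<lambda>_. 1) \<bullet> c = 1" using c(2,3) by (simp add: scalar_prod_def atLeast0LessThan)
    then have "x \<bullet> w = 1" using w(2)[OF c(2)] c(1) comm_scalar_prod[OF xc w(1)] by simp
    moreover have "x \<in> span (set (cols A))"
      using col_space_eq[OF A] c A xc unfolding col_space_def by auto
    ultimately show ?thesis using xc by blast
  qed
  obtain p where p: "p \<in> affine_span A" using ne by blast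
  have Dc: "?D \<subseteq> carrier_vec r" using aff by auto
  obtain T where T: "T \<subseteq> ?D" "finite T" "lin_span r T = lin_span r ?D"
    using finite_subset_spanning[OF Dc] .
  have Tc: "T \<subseteq> carrier_vec r" using T(1) Dc by (rule subset_trans)
  have "t \<bullet> w = 0" if "t \<in> T" for t
  proof -
    obtain x y where xy: "t = x - y" "x \<in> affine_span A" "y \<in> affine_span A" using \<open>t \<in> T\<close> T(1) by blast
    have "(x - y) \<bullet> w = x \<bullet> w - y \<bullet> w"
      using aff[OF xy(2)] aff[OF xy(3)] w(1) by (intro minus_scalar_prod_distrib) auto
    then show ?thesis using aff xy by simp
  qed
  then have "p \<notin> lin_span r T" using perp_span[OF Tc w(1), of p] aff[OF p] by auto
  then have "span_dim r (insert p T) = d + 1"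
    using span_dim_insert[OF Tc T(2)] aff[OF p] span_dim_cong[OF T(3)] dim by simp
  moreover have "span_dim r (insert p T) \<le> span_dim r (set (cols A))"
  proof (rule span_dim_mono)
    have cA: "set (cols A) \<subseteq> carrier_vec r" using A cols_dim by blast
    then show "set (cols A) \<subseteq> carrier_vec r" .
    interpret vec_space "TYPE('a)" r .
    have "x - y \<in> span (set (cols A))" if "x \<in> affine_span A" "y \<in> affine_span A" for x y
    proof -
      have "x + (- 1) \<cdot>\<^sub>v y \<in> span (set (cols A))"
        using aff that by (intro span_add1[OF cA] smult_in_span[OF cA]) auto
      moreover have "x + (- 1) \<cdot>\<^sub>v y = x - y" using aff[OF that(1)] aff[OF that(2)] by (intro eq_vecI) auto
      ultimately show ?thesis by simp
    qed
    then show "insert p T \<subseteq> span (set (cols A))" using T(1) aff[OF p] by blast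
  qed (use T in auto)
  moreover have "vec_space.rank r A = span_dim r (set (cols A))"
    by (simp add: vec_space.rank_def span_dim_def)
  ultimately show ?thesis by simp
qed

lemma rank_le_dim_row:
  fixes A :: "'a :: field mat"
  assumes A: "A \<in> carrier_mat r n"
  shows "vec_space.rank r A \<le> r"
proof -
  have "span_dim n (set (rows A)) \<le> card (set (rows A))"
    using A rows_carrier[of A] by (intro span_dim_le_card) auto
  also have "\<dots> \<le> r" using card_length[of "rows A"] A by simp
  finally show ?thesis using rank_eq_span_dim_rows[OF A] by simp
qed

section \<open>The rank of a chain matrix\<close>

lemma set_rows_append_rows:
  assumes "A \<in> carrier_mat r n" "M \<in> carrier_mat k n"
  shows "set (rows (A @\<^sub>r M)) = set (rows A) \<union> set (rows M)"
proof -
  have 1: "row (A @\<^sub>r M) i = row A i" if "i < r" for i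
    using assms that by (intro eq_vecI) (auto simp: append_rows_def)
  have 2: "row (A @\<^sub>r M) (r + i) = row M i" if "i < k" for i
    using assms that by (intro eq_vecI) (auto simp: append_rows_def)
  have "set (rows (A @\<^sub>r M)) = row (A @\<^sub>r M) ` {..<r + k}"
    using carrier_append_rows[OF assms] by (auto simp: rows_def atLeast0LessThan)
  also have "{..<r + k} = {..<r} \<union> (+) r ` {..<k}"
    using lessThan_atLeast0 image_add_atLeastLessThan[of r 0 k] ivl_disj_un_one(2)[of r "r + k"]
    by (auto simp: add.commute atLeast0LessThan)
  also have "row (A @\<^sub>r M) ` \<dots> = row A ` {..<r} \<union> row M ` {..<k}"
    unfolding image_Un image_image using 1 2
    by (intro arg_cong2[where f = "(\<union>)"] image_cong) auto
  also have "\<dots> = set (rows A) \<union> set (rows M)"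
    using assms by (auto simp: rows_def atLeast0LessThan)
  finally show ?thesis .
qed

text \<open>Vectors modulo the row space of \<open>A\<close> are detected by \<open>B\<^sup>T\<close>, because the columns of \<open>B\<close>
  span the annihilator of the row space.\<close>

lemma span_dim_rows_Un:
  fixes A B :: "'a :: field mat"
  assumes A: "A \<in> carrier_mat r n" and B: "B \<in> carrier_mat n e"
    and ker: "mat_kernel A = {B *\<^sub>v u | u. u \<in> carrier_vec e}"
    and S: "finite S" "S \<subseteq> carrier_vec n"
  shows "span_dim n (set (rows A) \<union> S) = span_dim n (set (rows A)) + span_dim e ((*\<^sub>v) B\<^sup>T ` S)"
  using S
proof (induction S rule: finite_induct)
  case empty
  then show ?case by (simp add: span_dim_empty)
next
  case (insert x S)
  have x: "x \<in> carrier_vec n" and S: "S \<subseteq> carrier_vec n" using insert.prems by auto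
  have rA: "set (rows A) \<subseteq> carrier_vec n" using A rows_carrier[of A] by simp
  have BS: "(*\<^sub>v) B\<^sup>T ` X \<subseteq> carrier_vec e" if "X \<subseteq> carrier_vec n" for X using B that by auto
  have tr: "(B\<^sup>T *\<^sub>v y) \<bullet> u = y \<bullet> (B *\<^sub>v u)" if "y \<in> carrier_vec n" "u \<in> carrier_vec e" for y u
    using transpose_vec_mult_scalar[OF B that(2,1)] .
  have kerA: "(\<forall>a \<in> set (rows A). a \<bullet> v = 0) \<longleftrightarrow> v \<in> mat_kernel A" if v: "v \<in> carrier_vec n" for v
  proof -
    have "(\<forall>a \<in> set (rows A). a \<bullet> v = 0) \<longleftrightarrow> (\<forall>i < r. row A i \<bullet> v = 0)"
      using A by (auto simp: rows_def)
    also have "\<dots> \<longleftrightarrow> A *\<^sub>v v = 0\<^sub>v r" using A by (auto simp: vec_eq_iff)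
    finally show ?thesis using mat_kernel[OF A] v by simp
  qed
  have "x \<in> lin_span n (set (rows A) \<union> S) \<longleftrightarrow>
    (\<forall>v \<in> carrier_vec n. (\<forall>a \<in> set (rows A) \<union> S. a \<bullet> v = 0) \<longrightarrow> x \<bullet> v = 0)"
    using rA S insert.hyps(1) x by (intro in_span_iff_perp) auto
  also have "\<dots> \<longleftrightarrow> (\<forall>v \<in> mat_kernel A. (\<forall>s \<in> S. s \<bullet> v = 0) \<longrightarrow> x \<bullet> v = 0)"
    using kerA mat_kernel_carrier[OF A] by blast
  also have "\<dots> \<longleftrightarrow> (\<forall>u \<in> carrier_vec e. (\<forall>t \<in> (*\<^sub>v) B\<^sup>T ` S. t \<bullet> u = 0) \<longrightarrow> (B\<^sup>T *\<^sub>v x) \<bullet> u = 0)"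
    unfolding ker using tr x S by (auto simp: subset_iff)
  also have "\<dots> \<longleftrightarrow> B\<^sup>T *\<^sub>v x \<in> lin_span e ((*\<^sub>v) B\<^sup>T ` S)"
    using BS[OF S] BS[of "{x}"] x insert.hyps(1) by (intro in_span_iff_perp[symmetric]) auto
  finally have mem: "x \<in> lin_span n (set (rows A) \<union> S) \<longleftrightarrow> B\<^sup>T *\<^sub>v x \<in> lin_span e ((*\<^sub>v) B\<^sup>T ` S)" .
  show ?case
    using span_dim_insert[of "set (rows A) \<union> S" n x] span_dim_insert[OF BS[OF S], of "B\<^sup>T *\<^sub>v x"]
      insert.IH[OF S] insert.hyps(1) rA S x BS[of "{x}"] mem by simp
qed

section \<open>Maximal chains of supports\<close>

definition zero_positions :: "'a :: zero vec \<Rightarrow> nat set" where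
  "zero_positions v = {i. i < dim_vec v \<and> v $ i = 0}"

lemma zero_positions_supp: "zero_positions (supp v) = zero_positions v"
  by (auto simp: zero_positions_def supp_def split: if_splits)

lemma supp_less_iff_zero_positions:
  "dim_vec s = dim_vec t \<Longrightarrow> supp_less s t \<longleftrightarrow> zero_positions t \<subset> zero_positions s"
  by (auto simp: zero_positions_def supp_less_def)

lemma finite_kernel_supports: "finite (kernel_supports A)"
proof -
  let ?f = "\<lambda>F. vec (dim_col A) (\<lambda>i. if i \<in> F then 0 else 1)"
  have "kernel_supports A \<subseteq> ?f ` Pow {..<dim_col A}"
  proof
    fix s assume "s \<in> kernel_supports A"
    then obtain v where v: "s = supp v" "dim_vec v = dim_col A"
      by (auto simp: kernel_supports_def mat_kernel_def)
    then have "s = ?f (zero_positions v)" by (auto simp: supp_def zero_positions_def vec_eq_iff)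
    moreover have "zero_positions v \<in> Pow {..<dim_col A}" using v by (auto simp: zero_positions_def)
    ultimately show "s \<in> ?f ` Pow {..<dim_col A}" by blast
  qed
  then show ?thesis using finite_subset by blast
qed

text \<open>A maximal chain of the finite poset of supports becomes a strictly increasing list when it is sorted
  by the size of the supports.\<close>

lemma maximal_support_chain_extends:
  assumes C: "C \<subseteq> kernel_supports A" "\<forall>s \<in> C. \<forall>t \<in> C. s = t \<or> supp_less s t \<or> supp_less t s"
  obtains ss where "maximal_support_chain A ss" "C \<subseteq> set ss"
proof -
  let ?ch = "pred_on.chain (kernel_supports A) supp_less"
  have chC: "?ch C" unfolding pred_on.chain_def using C by blast
  have sub: "X \<subseteq> kernel_supports A" if "?ch X" for X using that by (simp add: pred_on.chain_def)
  then obtain M where M: "finite M" "maximal M ?ch" "C \<subseteq> M"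
    using maximal_exists_superset[of "kernel_supports A" ?ch C, OF finite_kernel_supports sub chC] by blast
  then have mc: "pred_on.maxchain (kernel_supports A) supp_less M"
    unfolding maximal_def pred_on.maxchain_def by blast
  have tot: "s = t \<or> supp_less s t \<or> supp_less t s" if "s \<in> M" "t \<in> M" for s t
    using mc that unfolding pred_on.maxchain_def pred_on.chain_def by blast
  let ?key = "\<lambda>s :: 'a vec. card {i. i < dim_vec s \<and> s $ i \<noteq> 0}"
  obtain xs where xs: "set xs = M" "distinct xs" using finite_distinct_list[OF M(1)] by blast
  define ss where "ss = sort_key ?key xs"
  have ss: "set ss = M" "distinct ss" "sorted_wrt (\<lambda>s t. ?key s \<le> ?key t) ss"
    using xs sorted_sort_key[of ?key xs] by (auto simp: ss_def sorted_map)
  have less_key: "?key s < ?key t" if "supp_less s t" for s t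
    using that unfolding supp_less_def by (intro psubset_card_mono) auto
  have "sorted_wrt supp_less ss"
    unfolding sorted_wrt_iff_nth_less
  proof (intro allI impI)
    fix i j assume ij: "i < j" "j < length ss"
    have "ss ! i \<noteq> ss ! j" using ss(2) ij by (simp add: nth_eq_iff_index_eq)
    moreover have "\<not> supp_less (ss ! j) (ss ! i)"
      using less_key[of "ss ! j" "ss ! i"] sorted_wrt_nth_less[OF ss(3) ij] by auto
    ultimately show "supp_less (ss ! i) (ss ! j)" using tot[of "ss ! i" "ss ! j"] ij ss(1) by auto
  qed
  then have "maximal_support_chain A ss" using mc ss(1) by (simp add: maximal_support_chain_def)
  then show thesis using that M(3) ss(1) by blast
qed

lemma zero_positions_kernel:
  assumes "B \<in> carrier_mat n e" "u \<in> carrier_vec e"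
  shows "zero_positions (B *\<^sub>v u) = {i. i < dim_row B \<and> row B i \<bullet> u = 0}"
  using assms by (auto simp: zero_positions_def)

context
  fixes A B :: "'k :: field_char_0 mat" and r n e :: nat
  assumes A: "A \<in> carrier_mat r n" and B: "B \<in> carrier_mat n e"
    and ker: "mat_kernel A = {B *\<^sub>v u | u. u \<in> carrier_vec e}"
    and one: "vec n (\<lambda>_. 1) \<in> vec_space.row_space n A"
begin

text \<open>The vector \<open>(1, \<dots>, 1)\<close> is in the row space of \<open>A\<close>, hence orthogonal to every kernel vector \<open>B u\<close>.\<close>

lemma fam_sum_all_perp:
  assumes u: "u \<in> carrier_vec e"
  shows "(\<Sum>i<n. row B i \<bullet> u) = 0"
proof -
  obtain w where w: "w \<in> carrier_vec r"
    "\<And>c. c \<in> carrier_vec n \<Longrightarrow> w \<bullet> (A *\<^sub>v c) = vec n (\<lambda>_. 1) \<bullet> c"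
    using row_space_functional[OF A one] by blast
  have v: "B *\<^sub>v u \<in> mat_kernel A" using ker u by blast
  then have "B *\<^sub>v u \<in> carrier_vec n" "A *\<^sub>v (B *\<^sub>v u) = 0\<^sub>v r" using mat_kernelD[OF A v] by auto
  then have "vec n (\<lambda>_. 1) \<bullet> (B *\<^sub>v u) = 0" using w by (metis scalar_prod_right_zero)
  then show ?thesis using B u by (simp add: scalar_prod_def atLeast0LessThan)
qed

text \<open>The sign in the last part appears because a support is the indicator of the complement of its zero
  positions, and all rows of \<open>B\<close> add up to zero.\<close>

lemma kernel_support_flat:
  assumes s: "s \<in> kernel_supports A"
  shows "s \<in> carrier_vec n" "flat B (zero_positions s)"
    and "w \<in> carrier_vec e \<Longrightarrow> (B\<^sup>T *\<^sub>v s) \<bullet> w = - (fam_sum B (zero_positions s) \<bullet> w)"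
proof -
  obtain v where v: "v \<in> mat_kernel A" "s = supp v" using s by (auto simp: kernel_supports_def)
  obtain u where u: "u \<in> carrier_vec e" "v = B *\<^sub>v u" using v(1) ker by blast
  have vc: "v \<in> carrier_vec n" using B u by simp
  show sc: "s \<in> carrier_vec n" using v(2) vc by (simp add: supp_def)
  show fl: "flat B (zero_positions s)"
    using flat_zero_set[of u B] zero_positions_kernel[OF B u(1)] zero_positions_supp[of v] u v(2) B by auto
  assume w: "w \<in> carrier_vec e"
  let ?f = "\<lambda>i. row B i \<bullet> w"
  let ?Z = "zero_positions s"
  have Z: "?Z \<subseteq> {..<n}" using sc by (auto simp: zero_positions_def)
  have s01: "s $ i = (if i \<in> ?Z then 0 else 1)" if "i < n" for i
    using that sc vc v(2) by (auto simp: zero_positions_def supp_def)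
  have "(B\<^sup>T *\<^sub>v s) \<bullet> w = s \<bullet> (B *\<^sub>v w)" using transpose_vec_mult_scalar[OF B w sc] .
  also have "\<dots> = (\<Sum>i<n. s $ i * ?f i)" using B w by (simp add: scalar_prod_def atLeast0LessThan)
  also have "\<dots> = (\<Sum>i<n. if i \<in> ?Z then 0 else ?f i)" by (intro sum.cong refl) (simp add: s01)
  also have "\<dots> = (\<Sum>i\<in>{..<n} - ?Z. ?f i)" by (simp add: sum.If_cases Diff_eq)
  also have "\<dots> = - (\<Sum>i\<in>?Z. ?f i)"
    using sum.subset_diff[OF Z, of ?f] fam_sum_all_perp[OF w] by (simp add: add_eq_0_iff2)
  finally show "(B\<^sup>T *\<^sub>v s) \<bullet> w = - (fam_sum B ?Z \<bullet> w)"
    using fam_sum_scalar_prod[of w B ?Z] w B by simp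
qed

lemma rank_chain_matrix:
  assumes ss: "set ss \<subseteq> kernel_supports A"
  shows "vec_space.rank (dim_row (chain_matrix A ss)) (chain_matrix A ss) =
    vec_space.rank r A + span_dim e (fam_sum B ` zero_positions ` set ss)"
proof -
  let ?M = "mat_of_rows n ss"
  have sc: "set ss \<subseteq> carrier_vec n" using ss kernel_support_flat(1) by blast
  have M: "?M \<in> carrier_mat (length ss) n" by simp
  have cm: "chain_matrix A ss = A @\<^sub>r ?M" using A by (simp add: chain_matrix_def)
  have cc: "chain_matrix A ss \<in> carrier_mat (r + length ss) n"
    unfolding cm using carrier_append_rows[OF A M] .
  have "vec_space.rank (dim_row (chain_matrix A ss)) (chain_matrix A ss) =
    span_dim n (set (rows A) \<union> set ss)"
    using rank_eq_span_dim_rows[OF cc] cc set_rows_append_rows[OF A M] rows_mat_of_rows[OF sc]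
    by (simp add: cm)
  also have "\<dots> = vec_space.rank r A + span_dim e ((*\<^sub>v) B\<^sup>T ` set ss)"
    using span_dim_rows_Un[OF A B ker _ sc] rank_eq_span_dim_rows[OF A] by simp
  also have "span_dim e ((*\<^sub>v) B\<^sup>T ` set ss) = span_dim e (fam_sum B ` zero_positions ` set ss)"
  proof (rule span_dim_eq_perp)
    fix w :: "'k vec" assume w: "w \<in> carrier_vec e"
    show "(\<forall>t\<in>fam_sum B ` zero_positions ` set ss. t \<bullet> w = 0) \<longleftrightarrow> (\<forall>s\<in>(*\<^sub>v) B\<^sup>T ` set ss. s \<bullet> w = 0)"
      using kernel_support_flat(3)[OF _ w] ss by (auto simp: subset_iff)
  qed (use fam_sum_closed[of B] B sc in auto)
  finally show ?thesis .
qed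

lemma finite_nonsplitting_lengths: "finite {length Fs | Fs. flag B Fs \<and> non_splitting B Fs}"
proof (rule finite_subset)
  show "{length Fs | Fs. flag B Fs \<and> non_splitting B Fs} \<subseteq> {..dim_row B}"
    by (auto intro: length_flag_le)
qed simp

lemma chain_rank_le:
  assumes "maximal_support_chain A ss"
  shows "span_dim e (fam_sum B ` zero_positions ` set ss) \<le> lambda B"
proof -
  have ss: "sorted_wrt supp_less ss" "set ss \<subseteq> kernel_supports A"
    using assms by (auto simp: maximal_support_chain_def pred_on.maxchain_def pred_on.chain_def)
  define Es where "Es = map zero_positions (rev ss)"
  define F0 where "F0 = flat_closure B {}"
  have "sorted_wrt (\<lambda>s t. zero_positions t \<subseteq> zero_positions s) ss"
  proof (rule sorted_wrt_mono_rel[OF _ ss(1)])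
    fix s t assume "s \<in> set ss" "t \<in> set ss" "supp_less s t"
    moreover have "dim_vec s = dim_vec t"
      using kernel_support_flat(1) calculation(1,2) ss(2) by (metis carrier_vecD subsetD)
    ultimately show "zero_positions t \<subseteq> zero_positions s"
      using supp_less_iff_zero_positions by blast
  qed
  then have Es: "sorted_wrt (\<subseteq>) Es" by (simp add: Es_def sorted_wrt_map sorted_wrt_rev)
  have "\<forall>E \<in> set Es. flat B E" using kernel_support_flat(2) ss(2) unfolding Es_def by auto
  then have "\<forall>E \<in> set Es. flat B E \<and> F0 \<subseteq> E"
    unfolding F0_def using flat_closure_subset[OF _ empty_subsetI] by blast
  then obtain Gs where Gs: "flag B Gs" "non_splitting B Gs"
    "span_dim e (row B ` F0 \<union> fam_sum B ` set Es) \<le> length Gs"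
    using nonsplitting_flag_from_chain[OF nonsplitting_flag_to_empty[of B] Es] carrier_matD(2)[OF B]
    unfolding F0_def by auto
  have fF: "finite F0" by (simp add: F0_def flat_closure_def)
  have car: "row B ` F0 \<union> fam_sum B ` set Es \<subseteq> carrier_vec e"
    using fam_sum_closed[of B] row_image_carrier[of B] B by auto
  have "span_dim e (fam_sum B ` set Es) \<le> span_dim e (row B ` F0 \<union> fam_sum B ` set Es)"
    using fF subset_lin_span[OF car] by (intro span_dim_mono car) auto
  also have "\<dots> \<le> lambda B" unfolding lambda_def
    using Gs by (intro le_trans[OF Gs(3)] Max_ge finite_nonsplitting_lengths) blast
  finally show ?thesis by (simp add: Es_def image_image)
qed

text \<open>The full index set, whose sum is zero, violates the non-splitting condition at whatever place of the
  flag it stands, so every member of the flag is the zero set of a nonzero kernel vector.\<close>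

lemma nonsplitting_flag_in_chain:
  assumes fl: "flag B Fs" and ns: "non_splitting B Fs"
  obtains ss where "maximal_support_chain A ss" "set Fs \<subseteq> zero_positions ` set ss"
proof -
  have dims: "dim_row B = n" "dim_col B = e" using B by auto
  have flatF: "flat B (Fs ! j)" if "j < length Fs" for j using fl that by (simp add: flag_def)
  have proper: "Fs ! j \<noteq> {..<n}" if j: "j < length Fs" for j
  proof
    assume "Fs ! j = {..<n}"
    then have z: "fam_sum B (Fs ! j) \<bullet> u = 0" if "u \<in> carrier_vec e" for u
      using fam_sum_scalar_prod[of u B] fam_sum_all_perp[OF that] that dims by simp
    have sp: "fam_sum B (Fs ! j) \<in> fam_span B C" if "finite C" for C
      using in_fam_span_iff[OF that fam_sum_closed] z dims by blast
    show False
    proof (cases j)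
      case 0
      interpret vec_space "TYPE('k)" e .
      have "fam_sum B (Fs ! j) = 0\<^sub>v e"
        using sp[of "{}"] dims by (simp add: fam_span_def span_empty)
      moreover have "Fs \<noteq> []" using j by auto
      ultimately show False using ns 0 dims by (simp add: non_splitting_def)
    next
      case (Suc i)
      then have "fam_sum B (Fs ! j) \<notin> fam_span B (Fs ! i)" using ns j by (simp add: non_splitting_def)
      moreover have "finite (Fs ! i)" using flat_finite[OF flatF] Suc j by simp
      ultimately show False using sp by blast
    qed
  qed
  have ex: "\<exists>s \<in> kernel_supports A. zero_positions s = F" if F: "F \<in> set Fs" for F
  proof -
    have fF: "flat B F" "F \<noteq> {..<n}" using F flatF proper by (auto simp: in_set_conv_nth)
    obtain u where u: "u \<in> carrier_vec e" "{i. i < dim_row B \<and> row B i \<bullet> u = 0} = F"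
      using flat_is_zero_set[OF fF(1)] dims by blast
    have Z: "zero_positions (B *\<^sub>v u) = F" using zero_positions_kernel[OF B u(1)] u(2) by simp
    have "B *\<^sub>v u \<noteq> 0\<^sub>v (dim_col A)"
    proof
      assume "B *\<^sub>v u = 0\<^sub>v (dim_col A)"
      then have "zero_positions (B *\<^sub>v u) = {..<n}" using A by (auto simp: zero_positions_def)
      then show False using Z fF(2) by simp
    qed
    then have "supp (B *\<^sub>v u) \<in> kernel_supports A"
      using ker u(1) unfolding kernel_supports_def by blast
    then show ?thesis using Z zero_positions_supp by blast
  qed
  then obtain \<sigma> where \<sigma>: "\<And>F. F \<in> set Fs \<Longrightarrow> \<sigma> F \<in> kernel_supports A \<and> zero_positions (\<sigma> F) = F"
    by metis
  have dimS: "dim_vec (\<sigma> F) = n" if "F \<in> set Fs" for F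
    using kernel_support_flat(1) \<sigma>[OF that] by (metis carrier_vecD)
  have cmp: "F = G \<or> F \<subset> G \<or> G \<subset> F" if FG: "F \<in> set Fs" "G \<in> set Fs" for F G
  proof -
    obtain i j where ij: "i < length Fs" "F = Fs ! i" "j < length Fs" "G = Fs ! j"
      using FG by (auto simp: in_set_conv_nth)
    have s: "sorted_wrt (\<subset>) Fs" using fl by (simp add: flag_def)
    show ?thesis
      using sorted_wrt_nth_less[OF s, of i j] sorted_wrt_nth_less[OF s, of j i] ij
      by (cases i j rule: linorder_cases) auto
  qed
  have "s = t \<or> supp_less s t \<or> supp_less t s" if st: "s \<in> \<sigma> ` set Fs" "t \<in> \<sigma> ` set Fs" for s t
  proof -
    obtain F G where FG: "F \<in> set Fs" "s = \<sigma> F" "G \<in> set Fs" "t = \<sigma> G" using st by blast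
    have "supp_less s t \<longleftrightarrow> G \<subset> F" "supp_less t s \<longleftrightarrow> F \<subset> G"
      using supp_less_iff_zero_positions[of s t] supp_less_iff_zero_positions[of t s] FG dimS \<sigma> by auto
    then show ?thesis using cmp[OF FG(1,3)] FG by blast
  qed
  moreover have "\<sigma> ` set Fs \<subseteq> kernel_supports A" using \<sigma> by blast
  ultimately obtain ss where ss: "maximal_support_chain A ss" "\<sigma> ` set Fs \<subseteq> set ss"
    using maximal_support_chain_extends[of "\<sigma> ` set Fs" A] by metis
  have "set Fs \<subseteq> zero_positions ` set ss"
  proof
    fix F assume "F \<in> set Fs"
    then show "F \<in> zero_positions ` set ss" using \<sigma>[of F] ss(2) by (metis image_eqI image_subset_iff)
  qed
  with ss(1) show thesis by (rule that)
qed

lemma rho_eq_rank_plus_lambda: "rho A = vec_space.rank r A + lambda B"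
proof -
  let ?rk = "\<lambda>ss. vec_space.rank (dim_row (chain_matrix A ss)) (chain_matrix A ss)"
  have sub: "set ss \<subseteq> kernel_supports A" if "maximal_support_chain A ss" for ss
    using that by (simp add: maximal_support_chain_def pred_on.maxchain_def pred_on.chain_def)
  have le: "?rk ss \<le> vec_space.rank r A + lambda B" if "maximal_support_chain A ss" for ss
    using rank_chain_matrix[OF sub[OF that]] chain_rank_le[OF that] by simp
  have "{length Fs | Fs. flag B Fs \<and> non_splitting B Fs} \<noteq> {}"
    using nonsplitting_flag_to_empty[of B] unfolding nonsplitting_flag_to_def by blast
  then have "lambda B \<in> {length Fs | Fs. flag B Fs \<and> non_splitting B Fs}"
    unfolding lambda_def using finite_nonsplitting_lengths by (intro Max_in)
  then obtain Fs where Fs: "flag B Fs" "non_splitting B Fs" "lambda B = length Fs" by blast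
  obtain ss where ss: "maximal_support_chain A ss" "set Fs \<subseteq> zero_positions ` set ss"
    using nonsplitting_flag_in_chain[OF Fs(1,2)] .
  have car: "fam_sum B ` zero_positions ` set ss \<subseteq> carrier_vec e"
    using fam_sum_closed[of B] B by auto
  have "length Fs = span_dim e (fam_sum B ` set Fs)"
    using span_dim_nonsplitting_sums[OF Fs(1,2)] B by simp
  also have "\<dots> \<le> span_dim e (fam_sum B ` zero_positions ` set ss)"
  proof (rule span_dim_mono[OF car])
    show "fam_sum B ` set Fs \<subseteq> lin_span e (fam_sum B ` zero_positions ` set ss)"
      using subset_lin_span[OF car] image_mono[OF ss(2), of "fam_sum B"] by (rule subset_trans[rotated])
  qed simp_all
  finally have "?rk ss = vec_space.rank r A + lambda B"
    using rank_chain_matrix[OF sub[OF ss(1)]] Fs(3) le[OF ss(1)] by simp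
  then have attained: "vec_space.rank r A + lambda B \<in> {?rk ss | ss. maximal_support_chain A ss}"
    using ss(1) by force
  show ?thesis unfolding rho_def
  proof (rule Max_eqI)
    show bound: "x \<le> vec_space.rank r A + lambda B"
      if "x \<in> {?rk ss | ss. maximal_support_chain A ss}" for x using that le by blast
    show "finite {?rk ss | ss. maximal_support_chain A ss}"
      by (rule finite_subset[OF _ finite_atMost]) (rule subsetI, rule atMost_iff[THEN iffD2, OF bound])
  qed (rule attained)
qed

end

theorem theorem3p8:
  fixes A B :: "'k :: field_char_0 mat" and d n :: nat and m :: int
  assumes "A \<in> carrier_mat (d + 1) n"
    and "homogeneous A"
    and "\<not> pyramid A"
    and "affine_dim A = int d"
    and "m = int n - int d - 1"
    and "gale_dual A B"
  shows "int n - 1 - int (rho A) = m - 1 - int (lambda B)"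
proof -
  have "vec n (\<lambda>_. 1) \<in> vec_space.row_space n A"
    using assms(1,2) by (simp add: homogeneous_def)
  then have "rho A = vec_space.rank (d + 1) A + lambda B"
    using mat_kernel_gale_dual[OF assms(1,6)] by (intro rho_eq_rank_plus_lambda[OF assms(1)])
  moreover have "vec_space.rank (d + 1) A = d + 1"
    using affine_dim_less_rank[OF assms(1,2,4)] rank_le_dim_row[OF assms(1)] by simp
  ultimately show ?thesis using assms(5) by simp
qed

end
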